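(* Suppose the incoming ray $l_1$, starting from a fixed point $p$ and represented by $(s_1,\alpha_1)$, and the reflected ray $l_2$, starting from $q_0$ and represented by $(s_2,\alpha_2)$, are related by a diffeomorphism $\chi$, $(s_2,\alpha_2)=\chi(s_1,\alpha_1)$, where the point $q_0$ is chosen smoothly depending on $(s_1,\alpha_1)$. All derivatives $\frac{d}{d\alpha_1}$ below are taken with $p$ fixed. Then: (a) $p$ has a conjugate point $q$ belonging to $l_2$ if and only if $$\frac{d\alpha_2}{d\alpha_1}\,\Big\langle \frac{d q_0}{d\alpha_1},\, w(\alpha_2)\Big\rangle<0 .$$ (b) If this occurs, $q$ is the point of $l_2$ uniquely determined by $$\langle q, v(\alpha_2)\rangle=-\Big(\frac{d\alpha_2}{d\alpha_1}\Big)^{-1}\frac{d s_2}{d\alpha_1}.$$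
   Context: Work in $\mathbb{R}^2$ with $v(\alpha)=(\cos\alpha,\sin\alpha)$, $w(\alpha)=(-\sin\alpha,\cos\alpha)$. A pair $(s,\alpha)$ represents the directed line $\{x\in\mathbb{R}^2: x\cdot w(\alpha)=s\}$ with direction $v(\alpha)$ and unit normal $w(\alpha)$. A smooth family of broken rays is given by a diffeomorphism $\chi:(s_1,\alpha_1)\mapsto(s_2,\alpha_2)$ between open sets of directed lines: the broken ray is the union of an incoming part $l_1$ lying on the line $(s_1,\alpha_1)$ and an outgoing (reflected) part $l_2$ lying on the line $(s_2,\alpha_2)$. Fix $p$. For each angle $\alpha_1$ (in an open interval) let $l_1$ be the ray from $p$ in direction $v(\alpha_1)$, so $s_1=\langle p,w(\alpha_1)\rangle$, and let $(s_2,\alpha_2)=\chi(s_1,\alpha_1)$. Thus $s_2,\alpha_2$, and $q_0=q_0(s_1,\alpha_1)$ become smooth functions of the single variable $\alpha_1$, and $\frac{d}{d\alpha_1}$ denotes the corresponding derivative. The starting point $q_0$ of $l_2$ is reached at time $t_2$ (depending smoothly on $\alpha_1$) and satisfies $\langle q_0,w(\alpha_2)\rangle=s_2$. The exponential map at $p$ is $$\exp_p(t v(\alpha_1))=\begin{cases} l_1(t)=p+t\,v(\alpha_1), & 0\le t\le t_1,\\ l_2(t)=q_0+(t-t_2)\,v(\alpha_2), & t\ge t_2\ge t_1 .\end{cases}$$ A point $q=l_2(t)$ is a conjugate point of $p$ belonging to $l_2$ if $t>t_2$ and the differential of $(t,\alpha_1)\mapsto l_2(t)$ is not an isomorphism at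 $(t,\alpha_1)$. *)

theory Defs
  imports "HOL-Analysis.Analysis"
begin

text \<open>
  \<open>Ck_on k S f\<close>: \<open>f\<close> is \<open>k\<close> times continuously differentiable on \<open>S\<close>,
  expressed through iterated directional derivatives. Only meant for open \<open>S\<close>, where the
  Frechet derivative is determined by the values of \<open>f\<close> on \<open>S\<close>.
\<close>

primrec Ck_on ::
  "nat \<Rightarrow> 'a::euclidean_space set \<Rightarrow> ('a \<Rightarrow> 'b::euclidean_space) \<Rightarrow> bool" where
  "Ck_on 0 S f \<longleftrightarrow> continuous_on S f"
| "Ck_on (Suc k) S f \<longleftrightarrow>
     (\<forall>x\<in>S. f differentiable (at x)) \<and>
     (\<forall>h. Ck_on k S (\<lambda>x. frechet_derivative f (at x) h))"

definition smooth_on :: "'a::euclidean_space set \<Rightarrow> ('a \<Rightarrow> 'b::euclidean_space) \<Rightarrow> bool" where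
  "smooth_on S f \<longleftrightarrow> (\<forall>k. Ck_on k S f)"

definition diffeomorphism_between ::
  "'a::euclidean_space set \<Rightarrow> 'b::euclidean_space set \<Rightarrow> ('a \<Rightarrow> 'b) \<Rightarrow> bool" where
  "diffeomorphism_between U V f \<longleftrightarrow>
     open U \<and> open V \<and> bij_betw f U V \<and> smooth_on U f \<and> smooth_on V (inv_into U f)"

definition v :: "real \<Rightarrow> real^2" where
  "v \<alpha> = vector [cos \<alpha>, sin \<alpha>]"

definition w :: "real \<Rightarrow> real^2" where
  "w \<alpha> = vector [- sin \<alpha>, cos \<alpha>]"

text \<open>
  A pair \<open>(s, \<alpha>)\<close> is a coordinate for a directed line (with direction \<open>v \<alpha>\<close>). The angle is a
  real number, i.e. a local lift of the angle on the circle; families of lines are open sets of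
  such pairs.
\<close>

definition line :: "real \<times> real \<Rightarrow> (real^2) set" where
  "line = (\<lambda>(s, \<alpha>). {x. x \<bullet> w \<alpha> = s})"

text \<open>
  In the following, the argument \<open>a\<close> is the initial angle of the broken ray from \<open>p\<close>, and
  \<open>q0 a\<close>, \<open>t2 a\<close>, \<open>\<alpha>2 a\<close> are the starting point, starting time and direction angle of its
  reflected part. \<open>reflected_ray q0 t2 \<alpha>2 t a\<close> is the value of the exponential map
  at \<open>t *\<^sub>R v a\<close> for times \<open>t \<ge> t2 a\<close>; for smaller \<open>t\<close> the formula is merely the extension to the full line.
\<close>

definition reflected_ray ::
  "(real \<Rightarrow> real^2) \<Rightarrow> (real \<Rightarrow> real) \<Rightarrow> (real \<Rightarrow> real) \<Rightarrow> real \<Rightarrow> real \<Rightarrow> real^2" where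
  "reflected_ray q0 t2 \<alpha>2 t a = q0 a + (t - t2 a) *\<^sub>R v (\<alpha>2 a)"

definition conjugate_point ::
  "(real \<Rightarrow> real^2) \<Rightarrow> (real \<Rightarrow> real) \<Rightarrow> (real \<Rightarrow> real) \<Rightarrow> real \<Rightarrow> real^2 \<Rightarrow> bool" where
  "conjugate_point q0 t2 \<alpha>2 a q \<longleftrightarrow>
     (\<exists>t > t2 a. q = reflected_ray q0 t2 \<alpha>2 t a \<and>
        (\<exists>D. ((\<lambda>(t, a). reflected_ray q0 t2 \<alpha>2 t a) has_derivative D) (at (t, a)) \<and> \<not> bij D))"

end

theory Submission
  imports Defs
begin

text \<open>
  Along the reflected ray, \<open>\<partial>\<^sub>t = v \<alpha>2\<close> while the \<open>w \<alpha>2\<close>-component of \<open>\<partial>\<^sub>a\<close> is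
  \<open>q0' \<bullet> w \<alpha>2 + (t - t2) * \<alpha>2'\<close>, so conjugate points are the zeros \<open>t > t2\<close> of this affine
  function of \<open>t\<close>. It cannot vanish identically: differentiating \<open>s2 = q0 \<bullet> w \<alpha>2\<close> shows that
  \<open>q0' \<bullet> w \<alpha>2 = \<alpha>2' = 0\<close> would force \<open>s2' = \<alpha>2' = 0\<close>, whereas \<open>(s2', \<alpha>2')\<close> is the image of
  \<open>(s1', 1) \<noteq> 0\<close> under the injective differential of the diffeomorphism.
\<close>

section \<open>The moving orthonormal frame \<open>v a\<close>, \<open>w a\<close>\<close>

lemma v_eq_axis: "v a = cos a *\<^sub>R axis 1 1 + sin a *\<^sub>R axis 2 1"
  by (simp add: v_def vec_eq_iff forall_2 axis_def)

lemma w_eq_axis: "w a = - sin a *\<^sub>R axis 1 1 + cos a *\<^sub>R axis 2 1"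
  by (simp add: w_def vec_eq_iff forall_2 axis_def)

lemma has_vector_derivative_v: "(v has_vector_derivative w a) (at a)"
  unfolding v_eq_axis[abs_def] w_eq_axis
  by (auto intro!: derivative_eq_intros simp: has_real_derivative_iff_has_vector_derivative[symmetric])

lemma has_vector_derivative_w: "(w has_vector_derivative - v a) (at a)"
  unfolding w_eq_axis[abs_def] v_eq_axis
  by (auto intro!: derivative_eq_intros simp: has_real_derivative_iff_has_vector_derivative[symmetric])

lemma inner_v_w [simp]: "v a \<bullet> v a = 1" "w a \<bullet> w a = 1" "v a \<bullet> w a = 0" "w a \<bullet> v a = 0"
  by (simp_all add: v_def w_def inner_vec_def sum_2 power2_eq_square[symmetric] algebra_simps)

lemma v_w_decomposition: "y = (y \<bullet> v a) *\<^sub>R v a + (y \<bullet> w a) *\<^sub>R w a"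
proof -
  \<comment> \<open>The Pythagorean identity, in the shape that \<open>algebra_simps\<close> leaves
    in each coordinate.\<close>
  have z: "cos a * (cos a * z) + sin a * (sin a * z) = z" for z :: real
  proof -
    have "cos a * (cos a * z) + sin a * (sin a * z) = ((cos a)\<^sup>2 + (sin a)\<^sup>2) * z"
      by (simp only: power2_eq_square distrib_right mult.assoc)
    then show ?thesis
      by simp
  qed
  show ?thesis
    by (simp add: v_def w_def vec_eq_iff forall_2 inner_vec_def sum_2 algebra_simps z)
qed

text \<open>In the orthonormal basis \<open>v a\<close>, \<open>w a\<close> the map has a triangular
  matrix with diagonal entries 1 and \<open>u \<bullet> w a\<close>.\<close>

lemma bij_v_combination_iff:
  "bij (\<lambda>(\<tau>, h). \<tau> *\<^sub>R v a + h *\<^sub>R u) \<longleftrightarrow> u \<bullet> w a \<noteq> 0" (is "bij ?D \<longleftrightarrow> _")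
proof
  assume "bij ?D"
  show "u \<bullet> w a \<noteq> 0"
  proof
    assume "u \<bullet> w a = 0"
    then obtain k where k: "u = k *\<^sub>R v a"
      using v_w_decomposition[of u a] by (metis add.right_neutral scaleR_zero_left)
    \<comment> \<open>A nonzero kernel vector, since \<open>u\<close> is parallel to
      \<open>v a\<close>.\<close>
    have "?D (- k, 1) = ?D (0, 0)"
      by (simp add: k)
    then show False
      using \<open>bij ?D\<close> unfolding bij_def inj_def by (metis prod.inject zero_neq_one)
  qed
next
  assume nz: "u \<bullet> w a \<noteq> 0"
  show "bij ?D"
  proof (rule bijI)
    show "inj ?D"
    proof (rule injI, clarify)
      fix \<tau> h \<tau>' h'
      assume eq: "\<tau> *\<^sub>R v a + h *\<^sub>R u = \<tau>' *\<^sub>R v a + h' *\<^sub>R u"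
      \<comment> \<open>Pairing with \<open>w a\<close> removes the \<open>v a\<close> terms and
        isolates \<open>h\<close>; pairing with \<open>v a\<close> then gives
        \<open>\<tau>\<close>.\<close>
      have "h = h'"
        using arg_cong[OF eq, of "\<lambda>x. x \<bullet> w a"] nz by (simp add: inner_add_left)
      moreover have "\<tau> = \<tau>'"
        using arg_cong[OF eq, of "\<lambda>x. x \<bullet> v a"] \<open>h = h'\<close> by (simp add: inner_add_left)
      ultimately show "\<tau> = \<tau>' \<and> h = h'" by simp
    qed
    show "surj ?D"
    proof (rule surjI)
      fix y
      \<comment> \<open>Back substitution: the \<open>w a\<close> component of \<open>y\<close>
        determines \<open>h\<close>, and the \<open>v a\<close> component then determines the other
        coefficient.\<close>
      define h where "h = (y \<bullet> w a) / (u \<bullet> w a)"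
      have "(y \<bullet> v a - h * (u \<bullet> v a)) *\<^sub>R v a + h *\<^sub>R u
          = (y \<bullet> v a - h * (u \<bullet> v a)) *\<^sub>R v a
            + h *\<^sub>R ((u \<bullet> v a) *\<^sub>R v a + (u \<bullet> w a) *\<^sub>R w a)"
        by (simp flip: v_w_decomposition)
      also have "\<dots> = (y \<bullet> v a) *\<^sub>R v a + (h * (u \<bullet> w a)) *\<^sub>R w a"
        by (simp add: algebra_simps)
      also have "\<dots> = y"
        using nz by (simp add: h_def flip: v_w_decomposition)
      finally show "?D ((\<lambda>y. (y \<bullet> v a - (y \<bullet> w a) / (u \<bullet> w a) * (u \<bullet> v a),
          (y \<bullet> w a) / (u \<bullet> w a))) y) = y"
        by (simp add: h_def)
    qed
  qed
qed

section \<open>Differentials of smooth maps and diffeomorphisms\<close>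

lemma smooth_on_imp_differentiable:
  assumes "smooth_on S f" "x \<in> S"
  shows "f differentiable (at x)"
  using assms Ck_on.simps(2)[of 0 S f] unfolding smooth_on_def by blast

text \<open>By the chain rule, the derivative \<open>E\<close> of the inverse map at
  \<open>f x\<close> is a left inverse of \<open>D\<close>.\<close>

lemma diffeomorphism_between_derivative_inj:
  assumes diffeo: "diffeomorphism_between U V f" and x: "x \<in> U"
    and D: "(f has_derivative D) (at x)"
  shows "inj D"
proof -
  let ?g = "inv_into U f"
  have "open U" and bij: "bij_betw f U V" and g: "smooth_on V ?g"
    using diffeo by (auto simp: diffeomorphism_between_def)
  have "f x \<in> V"
    using bij x by (auto simp: bij_betw_def)
  then obtain E where "(?g has_derivative E) (at (f x))"
    using smooth_on_imp_differentiable[OF g] unfolding differentiable_def by blast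
  then have "((\<lambda>y. ?g (f y)) has_derivative (\<lambda>h. E (D h))) (at x)"
    using has_derivative_compose[OF D] by blast
  moreover have "?g (f y) = y" if "y \<in> U" for y
    using bij that by (simp add: bij_betw_def)
  \<comment> \<open>The inverse cancels \<open>f\<close> only on \<open>U\<close>; this suffices
    because derivatives are local and \<open>U\<close> is an open neighbourhood of
    \<open>x\<close>.\<close>
  ultimately have "((\<lambda>y. y) has_derivative (\<lambda>h. E (D h))) (at x)"
    by (rule has_derivative_transform_within_open[OF _ \<open>open U\<close> x])
  then have "(\<lambda>h. E (D h)) = (\<lambda>h. h)"
    using has_derivative_unique has_derivative_ident by blast
  then show "inj D"
    by (metis injI)
qed

section \<open>The differential of the exponential map along the reflected ray\<close>

lemma reflected_ray_has_derivative:
  assumes q0: "(q0 has_vector_derivative q') (at a)"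
    and t2: "(t2 has_real_derivative t2') (at a)"
    and \<alpha>2: "(\<alpha>2 has_real_derivative \<alpha>2') (at a)"
  shows "((\<lambda>(t, a). reflected_ray q0 t2 \<alpha>2 t a) has_derivative
    (\<lambda>(\<tau>, h). \<tau> *\<^sub>R v (\<alpha>2 a)
      + h *\<^sub>R (q' - t2' *\<^sub>R v (\<alpha>2 a) + ((t - t2 a) * \<alpha>2') *\<^sub>R w (\<alpha>2 a)))) (at (t, a))"
proof -
  have sndD: "(snd has_derivative snd) (at (t, a))"
    by (auto intro!: derivative_eq_intros)
  have "((v \<circ> \<alpha>2) has_vector_derivative (\<alpha>2' *\<^sub>R w (\<alpha>2 a))) (at a)"
    using vector_diff_chain_at[OF _ has_vector_derivative_v] \<alpha>2
    by (simp add: has_real_derivative_iff_has_vector_derivative)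
  then have vD: "((\<lambda>z. v (\<alpha>2 (snd z))) has_derivative (\<lambda>z. snd z *\<^sub>R \<alpha>2' *\<^sub>R w (\<alpha>2 a))) (at (t, a))"
    using has_derivative_compose[OF sndD, of "v \<circ> \<alpha>2"]
    by (simp add: has_vector_derivative_def)
  have qD: "((\<lambda>z. q0 (snd z)) has_derivative (\<lambda>z. snd z *\<^sub>R q')) (at (t, a))"
    using has_derivative_compose[OF sndD, of q0] q0 by (simp add: has_vector_derivative_def)
  have tD: "((\<lambda>z. t2 (snd z)) has_derivative (\<lambda>z. t2' * snd z)) (at (t, a))"
    using has_derivative_compose[OF sndD, of t2] t2 by (simp add: has_field_derivative_def)
  \<comment> \<open>Product rule for \<open>(t - t2 a) *\<^sub>R v (\<alpha>2 a)\<close>, regrouped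
    so that the factor of \<open>h\<close> is the partial derivative in \<open>a\<close>, as
    \<open>bij_v_combination_iff\<close> requires.\<close>
  show ?thesis
    using has_derivative_add[OF qD
        has_derivative_scaleR[OF has_derivative_diff[OF has_derivative_fst[OF has_derivative_ident] tD] vD]]
    by (simp add: reflected_ray_def case_prod_unfold algebra_simps)
qed

text \<open>Here \<open>\<tau> = t - t2 a\<close> is the distance travelled from
  \<open>q0 a\<close>. The derivative of \<open>t2\<close> drops out: it contributes only a multiple
  of \<open>v (\<alpha>2 a)\<close>, which is orthogonal to \<open>w (\<alpha>2 a)\<close>.\<close>

lemma conjugate_point_iff:
  assumes q0: "(q0 has_vector_derivative q') (at a)"
    and t2: "t2 differentiable (at a)"
    and \<alpha>2: "(\<alpha>2 has_real_derivative \<alpha>2') (at a)"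
  shows "conjugate_point q0 t2 \<alpha>2 a q \<longleftrightarrow>
    (\<exists>\<tau>>0. q = q0 a + \<tau> *\<^sub>R v (\<alpha>2 a) \<and> q' \<bullet> w (\<alpha>2 a) + \<tau> * \<alpha>2' = 0)"
proof -
  obtain t2' where t2': "(t2 has_real_derivative t2') (at a)"
    using t2 real_differentiable_def by blast
  note D = reflected_ray_has_derivative[OF q0 t2' \<alpha>2]
  have "(\<exists>D. ((\<lambda>(t, a). reflected_ray q0 t2 \<alpha>2 t a) has_derivative D) (at (t, a)) \<and> \<not> bij D)
      \<longleftrightarrow> q' \<bullet> w (\<alpha>2 a) + (t - t2 a) * \<alpha>2' = 0" for t
  proof -
    \<comment> \<open>Derivatives are unique, so the existentially quantified \<open>D\<close> must
      be the one computed above.\<close>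
    have "(\<exists>D. ((\<lambda>(t, a). reflected_ray q0 t2 \<alpha>2 t a) has_derivative D) (at (t, a)) \<and> \<not> bij D)
        \<longleftrightarrow> \<not> bij (\<lambda>(\<tau>, h). \<tau> *\<^sub>R v (\<alpha>2 a)
          + h *\<^sub>R (q' - t2' *\<^sub>R v (\<alpha>2 a) + ((t - t2 a) * \<alpha>2') *\<^sub>R w (\<alpha>2 a)))"
      using D[of t] has_derivative_unique by blast
    also have "\<dots> \<longleftrightarrow> q' \<bullet> w (\<alpha>2 a) + (t - t2 a) * \<alpha>2' = 0"
      unfolding bij_v_combination_iff by (simp add: inner_add_left inner_diff_left)
    finally show ?thesis .
  qed
  then have "conjugate_point q0 t2 \<alpha>2 a q \<longleftrightarrow>
      (\<exists>t>t2 a. q = q0 a + (t - t2 a) *\<^sub>R v (\<alpha>2 a) \<and> q' \<bullet> w (\<alpha>2 a) + (t - t2 a) * \<alpha>2' = 0)"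
    unfolding conjugate_point_def reflected_ray_def by simp
  also have "\<dots> \<longleftrightarrow> (\<exists>\<tau>>0. q = q0 a + \<tau> *\<^sub>R v (\<alpha>2 a) \<and> q' \<bullet> w (\<alpha>2 a) + \<tau> * \<alpha>2' = 0)"
    (is "(\<exists>t>_. ?P (t - t2 a)) \<longleftrightarrow> (\<exists>\<tau>>0. ?P \<tau>)")
  proof
    assume "\<exists>t>t2 a. ?P (t - t2 a)"
    then show "\<exists>\<tau>>0. ?P \<tau>" by (metis diff_gt_0_iff_gt)
  next
    assume "\<exists>\<tau>>0. ?P \<tau>"
    then obtain \<tau> where "\<tau> > 0" "?P \<tau>" by blast
    then show "\<exists>t>t2 a. ?P (t - t2 a)" by (intro exI[of _ "t2 a + \<tau>"]) simp
  qed
  finally show ?thesis .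
qed

text \<open>For \<open>m \<noteq> 0\<close> the only zero is \<open>- b / m\<close>, positive
  exactly when \<open>b\<close> and \<open>m\<close> have opposite signs. For \<open>m = 0\<close>
  the function is a nonzero constant; the assumption excludes the zero function.\<close>

lemma exists_positive_zero_iff:
  fixes b m :: real
  assumes "b \<noteq> 0 \<or> m \<noteq> 0"
  shows "(\<exists>\<tau>>0. b + \<tau> * m = 0) \<longleftrightarrow> m * b < 0"
proof
  assume "\<exists>\<tau>>0. b + \<tau> * m = 0"
  then obtain \<tau> where "\<tau> > 0" "b = - (\<tau> * m)" by (auto simp: eq_neg_iff_add_eq_0)
  then have "m \<noteq> 0" using assms by auto
  then have "0 < \<tau> * (m * m)" using \<open>\<tau> > 0\<close> by (auto simp: zero_less_mult_iff)
  then show "m * b < 0" using \<open>b = _\<close> by (simp add: algebra_simps)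
next
  assume "m * b < 0"
  then show "\<exists>\<tau>>0. b + \<tau> * m = 0"
    by (intro exI[of _ "- b / m"]) (auto simp: mult_less_0_iff divide_less_0_iff)
qed

theorem proposition1:
  fixes p :: "real^2"
    and U V :: "(real \<times> real) set"
    and chi :: "real \<times> real \<Rightarrow> real \<times> real"
    and Q0 :: "real \<times> real \<Rightarrow> real^2"
    and I :: "real set"
    and s1 s2 \<alpha>2 t1 t2 :: "real \<Rightarrow> real"
    and q0 :: "real \<Rightarrow> real^2"
    and \<alpha>1 :: real
  assumes "diffeomorphism_between U V chi"
    and "smooth_on U Q0"
    and "open I" and "is_interval I"
    and "\<And>a. a \<in> I \<Longrightarrow> s1 a = p \<bullet> w a"
    and "\<And>a. a \<in> I \<Longrightarrow> (s1 a, a) \<in> U"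
    and "\<And>a. a \<in> I \<Longrightarrow> (s2 a, \<alpha>2 a) = chi (s1 a, a)"
    and "\<And>a. a \<in> I \<Longrightarrow> q0 a = Q0 (s1 a, a)"
    and "\<And>a. a \<in> I \<Longrightarrow> q0 a \<in> line (s2 a, \<alpha>2 a)"
    and "smooth_on I t2"
    and "\<And>a. a \<in> I \<Longrightarrow> 0 \<le> t1 a \<and> t1 a \<le> t2 a"
    and "\<alpha>1 \<in> I"
  shows "((\<exists>q. conjugate_point q0 t2 \<alpha>2 \<alpha>1 q) \<longleftrightarrow>
            deriv \<alpha>2 \<alpha>1 * (vector_derivative q0 (at \<alpha>1) \<bullet> w (\<alpha>2 \<alpha>1)) < 0) \<and>
         (\<forall>q. conjugate_point q0 t2 \<alpha>2 \<alpha>1 q \<longrightarrow>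
            (\<forall>x. x \<in> (\<lambda>t. reflected_ray q0 t2 \<alpha>2 t \<alpha>1) ` {t2 \<alpha>1..} \<and>
                 x \<bullet> v (\<alpha>2 \<alpha>1) = - (inverse (deriv \<alpha>2 \<alpha>1) * deriv s2 \<alpha>1) \<longleftrightarrow> x = q))"
proof -
  let ?v = "v (\<alpha>2 \<alpha>1)" and ?w = "w (\<alpha>2 \<alpha>1)"
  \<comment> \<open>The derivative of \<open>p \<bullet> w a\<close> with \<open>p\<close> fixed, as
    \<open>w\<close> has derivative \<open>- v\<close>.\<close>
  define s1' where "s1' = p \<bullet> - v \<alpha>1"
  have s1D: "(s1 has_vector_derivative s1') (at \<alpha>1)"
  proof (rule has_vector_derivative_transform_within_open[OF _ assms(3,12)])
    show "((\<lambda>a. p \<bullet> w a) has_vector_derivative s1') (at \<alpha>1)"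
      unfolding s1'_def
      by (rule bounded_linear.has_vector_derivative[OF bounded_linear_inner_right
          has_vector_derivative_w])
  qed (simp add: assms(5))
  have curveD: "((\<lambda>a. (s1 a, a)) has_vector_derivative (s1', 1)) (at \<alpha>1)"
    using has_vector_derivative_Pair[OF s1D has_vector_derivative_id] by simp
  have in_U: "(s1 \<alpha>1, \<alpha>1) \<in> U"
    using assms(6,12) by blast
  have "smooth_on U chi"
    using assms(1) by (simp add: diffeomorphism_between_def)
  then obtain C where C: "(chi has_derivative C) (at (s1 \<alpha>1, \<alpha>1))"
    using smooth_on_imp_differentiable in_U unfolding differentiable_def by blast
  \<comment> \<open>The vector \<open>(s1', 1)\<close> is the velocity of the curve of incoming
    lines through \<open>p\<close>; its image components turn out to be the derivatives of
    \<open>s2\<close> and \<open>\<alpha>2\<close>.\<close>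
  obtain m0 m where C_eq: "C (s1', 1) = (m0, m)"
    by fastforce
  have "((\<lambda>a. chi (s1 a, a)) has_vector_derivative (m0, m)) (at \<alpha>1)"
    using has_derivative_compose[OF curveD[unfolded has_vector_derivative_def] C]
      linear_scale[OF has_derivative_linear[OF C]]
    by (simp add: has_vector_derivative_def C_eq flip: scaleR_Pair)
  then have pairD: "((\<lambda>a. (s2 a, \<alpha>2 a)) has_vector_derivative (m0, m)) (at \<alpha>1)"
    by (rule has_vector_derivative_transform_within_open[OF _ assms(3,12)]) (simp add: assms(7))
  have s2D: "(s2 has_real_derivative m0) (at \<alpha>1)"
    using bounded_linear.has_vector_derivative[OF bounded_linear_fst pairD]
    by (simp add: has_real_derivative_iff_has_vector_derivative)
  have \<alpha>2D: "(\<alpha>2 has_real_derivative m) (at \<alpha>1)"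
    using bounded_linear.has_vector_derivative[OF bounded_linear_snd pairD]
    by (simp add: has_real_derivative_iff_has_vector_derivative)
  obtain E where E: "(Q0 has_derivative E) (at (s1 \<alpha>1, \<alpha>1))"
    using smooth_on_imp_differentiable[OF assms(2) in_U] unfolding differentiable_def by blast
  define q' where "q' = E (s1', 1)"
  have "((\<lambda>a. Q0 (s1 a, a)) has_vector_derivative q') (at \<alpha>1)"
    using has_derivative_compose[OF curveD[unfolded has_vector_derivative_def] E]
      linear_scale[OF has_derivative_linear[OF E]]
    by (simp add: has_vector_derivative_def q'_def flip: scaleR_Pair)
  then have q0D: "(q0 has_vector_derivative q') (at \<alpha>1)"
    by (rule has_vector_derivative_transform_within_open[OF _ assms(3,12)]) (simp add: assms(8))
  define b where "b = q' \<bullet> ?w"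
  have "((w \<circ> \<alpha>2) has_vector_derivative (m *\<^sub>R - ?v)) (at \<alpha>1)"
    using vector_diff_chain_at[OF _ has_vector_derivative_w] \<alpha>2D
    by (simp add: has_real_derivative_iff_has_vector_derivative)
  from bounded_bilinear.has_vector_derivative[OF bounded_bilinear_inner q0D this]
  have "((\<lambda>a. q0 a \<bullet> w (\<alpha>2 a)) has_vector_derivative
      (q0 \<alpha>1 \<bullet> (m *\<^sub>R - ?v) + q' \<bullet> ?w)) (at \<alpha>1)"
    by (simp add: o_def)
  then have "(s2 has_vector_derivative (q0 \<alpha>1 \<bullet> (m *\<^sub>R - ?v) + q' \<bullet> ?w)) (at \<alpha>1)"
  proof (rule has_vector_derivative_transform_within_open[OF _ assms(3,12)])
    show "q0 a \<bullet> w (\<alpha>2 a) = s2 a" if "a \<in> I" for a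
      using assms(9)[OF that] by (simp add: line_def)
  qed
  then have "(s2 has_vector_derivative (b - m * (q0 \<alpha>1 \<bullet> ?v))) (at \<alpha>1)"
    by (simp add: b_def)
  \<comment> \<open>The chain rule through \<open>chi\<close> and the product rule for
    \<open>q0 a \<bullet> w (\<alpha>2 a)\<close> give the same derivative of
    \<open>s2\<close>.\<close>
  then have m0_eq: "m0 = b - m * (q0 \<alpha>1 \<bullet> ?v)"
    using s2D DERIV_unique has_real_derivative_iff_has_vector_derivative by blast
  have "(m0, m) \<noteq> 0"
  proof
    assume "(m0, m) = 0"
    then have "C (s1', 1) = C 0"
      using C_eq linear_0[OF has_derivative_linear[OF C]] by simp
    then have "(s1', 1 :: real) = 0"
      by (rule injD[OF diffeomorphism_between_derivative_inj[OF assms(1) in_U C]])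
    then show False
      by (simp add: zero_prod_def)
  qed
  then have nondegenerate: "b \<noteq> 0 \<or> m \<noteq> 0"
    using m0_eq by (auto simp: zero_prod_def)
  have conj_iff: "conjugate_point q0 t2 \<alpha>2 \<alpha>1 q \<longleftrightarrow>
      (\<exists>\<tau>>0. q = q0 \<alpha>1 + \<tau> *\<^sub>R ?v \<and> b + \<tau> * m = 0)" for q
    unfolding b_def
    by (rule conjugate_point_iff[OF q0D _ \<alpha>2D])
      (rule smooth_on_imp_differentiable[OF assms(10,12)])
  have "(\<exists>q. conjugate_point q0 t2 \<alpha>2 \<alpha>1 q) \<longleftrightarrow> m * b < 0"
    unfolding conj_iff using exists_positive_zero_iff[OF nondegenerate] by blast
  moreover have "x \<in> (\<lambda>t. reflected_ray q0 t2 \<alpha>2 t \<alpha>1) ` {t2 \<alpha>1..} \<and>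
      x \<bullet> ?v = - (inverse m * m0) \<longleftrightarrow> x = q"
    if conj: "conjugate_point q0 t2 \<alpha>2 \<alpha>1 q" for q x
  proof -
    obtain \<tau> where \<tau>: "\<tau> > 0" "q = q0 \<alpha>1 + \<tau> *\<^sub>R ?v" "b + \<tau> * m = 0"
      using conj conj_iff by blast
    \<comment> \<open>If \<open>m\<close> vanished, the zero condition would force
      \<open>b = 0\<close> as well.\<close>
    then have "m \<noteq> 0" using nondegenerate by auto
    have "b = - (\<tau> * m)" using \<tau>(3) by linarith
    then have "m0 = - (m * (q0 \<alpha>1 \<bullet> ?v + \<tau>))"
      by (simp add: m0_eq algebra_simps)
    \<comment> \<open>The prescribed value is thus the \<open>?v\<close> component of
      \<open>q0 \<alpha>1 + \<tau> *\<^sub>R ?v\<close>, that is, of \<open>q\<close>.\<close>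
    then have val: "- (inverse m * m0) = q0 \<alpha>1 \<bullet> ?v + \<tau>"
      using \<open>m \<noteq> 0\<close> by simp
    have "q = reflected_ray q0 t2 \<alpha>2 (t2 \<alpha>1 + \<tau>) \<alpha>1"
      by (simp add: reflected_ray_def \<tau>(2))
    then have "q \<in> (\<lambda>t. reflected_ray q0 t2 \<alpha>2 t \<alpha>1) ` {t2 \<alpha>1..}"
      using \<tau>(1) by auto
    \<comment> \<open>Uniqueness: along the ray the \<open>?v\<close> component grows with slope 1
      in \<open>t\<close>, so its value determines the point.\<close>
    then show ?thesis
      unfolding val using \<tau>(2) by (auto simp: reflected_ray_def inner_add_left)
  qed
  ultimately show ?thesis
    unfolding DERIV_imp_deriv[OF \<alpha>2D] DERIV_imp_deriv[OF s2D]
      vector_derivative_at[OF q0D] b_def by blast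
qed

end
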